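(* Consider a single DRCCP ($I=1$) under the type $\infty$-Wasserstein ambiguity set with affine mappings $a_1(x)=x$, $b_1(x)=b_1$ (a constant), where the reference distribution is elliptical, $\tilde\zeta\sim\mathbb{P}_{\mathrm E}(\mu,\Sigma,\hat g)$. Suppose that $\Sigma=\mu\mu^\top$, that $\mu^\top x\ge0$ for every $x\in\mathcal X$, and that $1+\Phi^{-1}(1-\varepsilon)+\theta\ge0$. Then ALSO-X# is exact, i.e., $v^{A\#}=v^*$.
   Context: $\mathcal X\subseteq\mathbb{R}^n$, $c\in\mathbb{R}^n$, $b_1\in\mathbb{R}$, $\varepsilon\in(0,1)$, $\theta\ge0$, $(y)_+=\max\{y,0\}$. The norm defining the Wasserstein distance is the generalized Mahalanobis norm $\|y\|=\sqrt{y^\top\Sigma^\dagger y}$ ($\Sigma^\dagger$ the pseudo-inverse), whose dual norm is taken to be $\|x\|_*=\sqrt{x^\top\Sigma x}$. Elliptical distribution $\mathbb{P}_{\mathrm E}(\mu,\Sigma,\hat g)$: location $\mu\in\mathbb{R}^n$, positive semidefinite $\Sigma$, generating function $\hat g$, with density $\bar k\,\hat g(\frac12(x-\mu)^\top\Sigma^{-1}(x-\mu))$, $\bar k>0$ a normalization constant. The standard univariate elliptical distribution $\mathbb{P}_{\mathrm E}(0,1,\hat g)$ has density $\varphi(z)=\bar k\hat g(z^2/2)$ and cumulative distribution function $\Phi(\tau)=\int_{-\infty}^\tau\bar k\hat g(z^2/2)\,dz$. For singular $\Sigma$ it is understood through its projections: for every $x\in\mathbb{R}^n$, $x^\top\tilde\zeta$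 has the law of $\mu^\top x+\sqrt{x^\top\Sigma x}\,Z$ with $Z\sim\mathbb{P}_{\mathrm E}(0,1,\hat g)$. The reference distribution $\mathbb{P}_\zeta$ is assumed sub-Gaussian. DRCCP: $v^*=\min\{c^\top x:x\in\mathcal X,\ \mathbb{P}_\zeta\{\theta\|x\|_*+x^\top\tilde\zeta\le b_1\}\ge1-\varepsilon\}$. ALSO-X#: $v^{A\#}$ is the minimum (infimum) of all $t$ for which there is $(x^*,\beta^* )\in\arg\min\{\varepsilon\beta+\mathbb{E}_{\mathbb{P}_\zeta}[(\theta\|x\|_*+x^\top\tilde\zeta-b_1-\beta)_+]:x\in\mathcal X,\ c^\top x\le t,\ \beta\le0\}$ with $\mathbb{P}_\zeta\{\theta\|x^*\|_*+(x^* )^\top\tilde\zeta\le b_1\}\ge1-\varepsilon$. Conventions: an infimum over the empty set is $+\infty$; the minimization problems are understood to attain their minima whenever feasible. *)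

theory Defs
  imports "HOL-Probability.Probability"
begin

definition elliptical_generator :: "(real \<Rightarrow> real) \<Rightarrow> bool" where
  "elliptical_generator g \<longleftrightarrow>
     (\<forall>u\<ge>0. 0 \<le> g u) \<and>
     integrable lborel (\<lambda>z. g (z\<^sup>2 / 2)) \<and>
     0 < (LINT z|lborel. g (z\<^sup>2 / 2))"

definition std_elliptical_density :: "(real \<Rightarrow> real) \<Rightarrow> real \<Rightarrow> real" where
  "std_elliptical_density g z = g (z\<^sup>2 / 2) / (LINT y|lborel. g (y\<^sup>2 / 2))"

definition std_elliptical :: "(real \<Rightarrow> real) \<Rightarrow> real measure" where
  "std_elliptical g = density lborel (\<lambda>z. ennreal (std_elliptical_density g z))"

definition std_elliptical_cdf :: "(real \<Rightarrow> real) \<Rightarrow> real \<Rightarrow> real" where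
  "std_elliptical_cdf g \<tau> = (LINT z:{..\<tau>}|lborel. std_elliptical_density g z)"

text \<open>The generator may vanish on intervals, so the distribution function need not be injective;
  its inverse is the usual quantile function.\<close>

definition std_elliptical_quantile :: "(real \<Rightarrow> real) \<Rightarrow> real \<Rightarrow> real" where
  "std_elliptical_quantile g p = Inf {\<tau>. p \<le> std_elliptical_cdf g \<tau>}"

text \<open>A nonsingular \<open>\<Sigma>\<close> gives a distribution with a Lebesgue density (where \<open>k\<close> is forced to be the
  normalization constant because \<open>P\<close> is a probability measure).  For singular \<open>\<Sigma>\<close> there is no
  density and the distribution is determined by its one-dimensional projections.\<close>

definition elliptical ::
  "(real^'n) measure \<Rightarrow> real^'n \<Rightarrow> real^'n^'n \<Rightarrow> (real \<Rightarrow> real) \<Rightarrow> bool" where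
  "elliptical P \<mu> \<Sigma> g \<longleftrightarrow>
     prob_space P \<and> sets P = sets borel \<and>
     elliptical_generator g \<and>
     transpose \<Sigma> = \<Sigma> \<and> (\<forall>x. 0 \<le> x \<bullet> (\<Sigma> *v x)) \<and>
     (if invertible \<Sigma>
      then \<exists>k>0. P = density lborel
             (\<lambda>z. ennreal (k * g ((1/2) * ((z - \<mu>) \<bullet> (matrix_inv \<Sigma> *v (z - \<mu>))))))
      else \<forall>x. distr P borel (\<lambda>\<zeta>. x \<bullet> \<zeta>) =
               distr (std_elliptical g) borel (\<lambda>z. \<mu> \<bullet> x + sqrt (x \<bullet> (\<Sigma> *v x)) * z))"

definition sub_gaussian :: "(real^'n) measure \<Rightarrow> bool" where
  "sub_gaussian P \<longleftrightarrow>
     (\<exists>C1>0. \<exists>C2>0. \<forall>t\<ge>0. measure P {\<zeta> \<in> space P. t \<le> norm \<zeta>} \<le> C1 * exp (- C2 * t\<^sup>2))"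

text \<open>The dual of the generalized Mahalanobis norm \<open>\<lambda>y. sqrt (y \<bullet> (\<Sigma>\<^sup>\<dagger> *v y))\<close>, where
  \<open>\<Sigma>\<^sup>\<dagger>\<close> is the pseudo-inverse.\<close>

definition mahalanobis_dual_norm :: "real^'n^'n \<Rightarrow> real^'n \<Rightarrow> real" where
  "mahalanobis_dual_norm \<Sigma> x = sqrt (x \<bullet> (\<Sigma> *v x))"

definition chance_constraint ::
  "(real^'n) measure \<Rightarrow> real^'n^'n \<Rightarrow> real \<Rightarrow> real \<Rightarrow> real \<Rightarrow> real^'n \<Rightarrow> bool" where
  "chance_constraint P \<Sigma> \<theta> b \<epsilon> x \<longleftrightarrow>
     measure P {\<zeta> \<in> space P. \<theta> * mahalanobis_dual_norm \<Sigma> x + x \<bullet> \<zeta> \<le> b} \<ge> 1 - \<epsilon>"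

definition drccp_feasible ::
  "(real^'n) measure \<Rightarrow> real^'n^'n \<Rightarrow> real \<Rightarrow> real \<Rightarrow> real \<Rightarrow> (real^'n) set \<Rightarrow> real^'n \<Rightarrow> bool" where
  "drccp_feasible P \<Sigma> \<theta> b \<epsilon> X x \<longleftrightarrow> x \<in> X \<and> chance_constraint P \<Sigma> \<theta> b \<epsilon> x"

definition drccp_value ::
  "(real^'n) measure \<Rightarrow> real^'n^'n \<Rightarrow> real \<Rightarrow> real \<Rightarrow> real \<Rightarrow> (real^'n) set \<Rightarrow> real^'n \<Rightarrow> ereal" where
  "drccp_value P \<Sigma> \<theta> b \<epsilon> X c = Inf {ereal (c \<bullet> x) | x. drccp_feasible P \<Sigma> \<theta> b \<epsilon> X x}"

definition alsox_objective ::
  "(real^'n) measure \<Rightarrow> real^'n^'n \<Rightarrow> real \<Rightarrow> real \<Rightarrow> real \<Rightarrow> (real^'n) \<times> real \<Rightarrow> real" where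
  "alsox_objective P \<Sigma> \<theta> b \<epsilon> = (\<lambda>(x, \<beta>).
     \<epsilon> * \<beta> + (LINT \<zeta>|P. max (\<theta> * mahalanobis_dual_norm \<Sigma> x + x \<bullet> \<zeta> - b - \<beta>) 0))"

definition alsox_feasible ::
  "(real^'n) set \<Rightarrow> real^'n \<Rightarrow> real \<Rightarrow> (real^'n) \<times> real \<Rightarrow> bool" where
  "alsox_feasible X c t = (\<lambda>(x, \<beta>). x \<in> X \<and> c \<bullet> x \<le> t \<and> \<beta> \<le> 0)"

definition alsox_argmin ::
  "(real^'n) measure \<Rightarrow> real^'n^'n \<Rightarrow> real \<Rightarrow> real \<Rightarrow> real \<Rightarrow> (real^'n) set \<Rightarrow> real^'n \<Rightarrow> real \<Rightarrow>
     ((real^'n) \<times> real) set" where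
  "alsox_argmin P \<Sigma> \<theta> b \<epsilon> X c t =
     {p. is_arg_min (alsox_objective P \<Sigma> \<theta> b \<epsilon>) (alsox_feasible X c t) p}"

definition alsox_value ::
  "(real^'n) measure \<Rightarrow> real^'n^'n \<Rightarrow> real \<Rightarrow> real \<Rightarrow> real \<Rightarrow> (real^'n) set \<Rightarrow> real^'n \<Rightarrow> ereal" where
  "alsox_value P \<Sigma> \<theta> b \<epsilon> X c =
     Inf {ereal t | t. \<exists>(x, \<beta>) \<in> alsox_argmin P \<Sigma> \<theta> b \<epsilon> X c t. chance_constraint P \<Sigma> \<theta> b \<epsilon> x}"

end

theory Submission
  imports Defs
begin

text \<open>Because \<open>\<Sigma> = \<mu>\<mu>\<^sup>T\<close>, a decision \<open>x\<close> enters the problem only through the number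
  \<open>s = \<mu> \<bullet> x \<ge> 0\<close>: the dual norm of \<open>x\<close> is \<open>s\<close>, and \<open>x \<bullet> \<zeta>\<close> has the law of \<open>s (1 + Z)\<close> with \<open>Z\<close>
  standard elliptical (\<open>elliptical_rank_one_projection\<close>). Let \<open>q\<close> be the \<open>(1 - \<epsilon>)\<close>-quantile of \<open>Z\<close>
  and \<open>\<kappa> = 1 + q + \<theta> \<ge> 0\<close>. Then \<open>x\<close> satisfies the chance constraint iff \<open>s \<kappa> \<le> b\<close>
  (\<open>chance_constraint_iff_scaled_quantile\<close>).

  For fixed \<open>x\<close> the objective of ALSO-X# as a function of \<open>\<beta>\<close> is the Rockafellar--Uryasev function of
  \<open>s (1 + \<theta> + Z) - b\<close>. Without the sign constraint on \<open>\<beta>\<close> it is minimal at the quantile \<open>s \<kappa> - b\<close>,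
  and its minimum is the affine function \<open>m(s) = \<epsilon> (s \<kappa> - b) + s E(Z - q)\<^sub>+\<close> of \<open>s\<close>.
  If \<open>x\<close> satisfies the chance constraint, then \<open>s \<kappa> - b \<le> 0\<close>, so the value \<open>m(s)\<close> is reached
  by an admissible \<open>\<beta>\<close>. If \<open>y\<close> with \<open>s' = \<mu> \<bullet> y\<close> violates it, then
  \<open>s \<kappa> \<le> b < s' \<kappa>\<close> forces \<open>s < s'\<close> and \<open>\<kappa> > 0\<close>, hence \<open>m(s) < m(s')\<close>, and every admissible \<open>\<beta>\<close>
  gives \<open>y\<close> an objective of at least \<open>m(s')\<close>. So as soon as the budget \<open>t\<close> admits
  a feasible decision, every minimizer satisfies the chance constraint
  (\<open>alsox_minimizer_satisfies_chance_constraint\<close>). Taking \<open>t = c \<bullet> x\<close> for feasible \<open>x\<close> bounds the ALSO-X#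
  value by the optimal value; the converse bound holds because an accepted minimizer is itself
  feasible with cost at most \<open>t\<close>.\<close>

section \<open>Integrability of sub-Gaussian vectors\<close>

text \<open>The layer-cake sum of the tails \<open>t \<le> norm \<zeta>\<close> over natural \<open>t\<close> is dominated by a geometric series,
  as \<open>t \<le> t\<^sup>2\<close> for such \<open>t\<close>.  Integrability matters here because the Bochner integral of a
  non-integrable function is zero, which would destroy the lower bound on the objective.\<close>

lemma sub_gaussian_integrable_norm:
  fixes P :: "(real^'n) measure"
  assumes "prob_space P" and sets[measurable_cong]: "sets P = sets borel" and "sub_gaussian P"
  shows "integrable P norm"
proof -
  interpret prob_space P by fact
  obtain C1 C2 where C: "C1 > 0" "C2 > 0"
    and tail: "\<And>t. 0 \<le> t \<Longrightarrow> prob {\<zeta> \<in> space P. t \<le> norm \<zeta>} \<le> C1 * exp (- C2 * t\<^sup>2)"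
    using assms(3) unfolding sub_gaussian_def by blast
  have [measurable]: "(\<lambda>\<zeta>. nat \<lceil>norm \<zeta>\<rceil>) \<in> measurable P (count_space UNIV)"
    by measurable
  have geometric: "prob {\<zeta> \<in> space P. real t \<le> norm \<zeta>} \<le> C1 * exp (- C2) ^ t" for t :: nat
  proof -
    have "real t \<le> (real t)\<^sup>2"
      by (cases t) (auto simp: power2_eq_square)
    then have "exp (- C2 * (real t)\<^sup>2) \<le> exp (- C2 * real t)"
      using C by simp
    also have "\<dots> = exp (- C2) ^ t"
      by (simp add: exp_of_nat_mult[symmetric] mult.commute)
    finally show ?thesis
      using tail[of "real t"] C by (meson mult_left_mono less_imp_le of_nat_0_le_iff order_trans)
  qed
  have "(\<integral>\<^sup>+\<zeta>. ennreal (norm \<zeta>) \<partial>P) \<le> (\<integral>\<^sup>+\<zeta>. of_nat (nat \<lceil>norm \<zeta>\<rceil>) \<partial>P)"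
    by (intro nn_integral_mono) (auto simp: ennreal_of_nat_eq_real_of_nat intro!: ennreal_leI)
  also have "\<dots> = (\<Sum>t. emeasure P {\<zeta>\<in>space P. t < nat \<lceil>norm \<zeta>\<rceil>})"
    by (rule nn_integral_nat_function) measurable
  also have "\<dots> \<le> (\<Sum>t. ennreal (C1 * exp (- C2) ^ t))"
  proof (intro suminf_le)
    fix t :: nat
    have "emeasure P {\<zeta>\<in>space P. t < nat \<lceil>norm \<zeta>\<rceil>} \<le> emeasure P {\<zeta>\<in>space P. real t \<le> norm \<zeta>}"
      by (intro emeasure_mono) (auto simp: zless_nat_eq_int_zless less_ceiling_iff less_imp_le)
    also have "\<dots> \<le> ennreal (C1 * exp (- C2) ^ t)"
      by (simp add: emeasure_eq_measure geometric ennreal_leI)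
    finally show "emeasure P {\<zeta>\<in>space P. t < nat \<lceil>norm \<zeta>\<rceil>} \<le> ennreal (C1 * exp (- C2) ^ t)" .
  qed auto
  also have "\<dots> < \<infinity>"
  proof -
    have "summable (\<lambda>t. C1 * exp (- C2) ^ t)"
      using C by (intro summable_mult summable_geometric) auto
    then show ?thesis
      using C by (subst suminf_ennreal2) auto
  qed
  finally show ?thesis
    by (auto simp: integrable_iff_bounded)
qed

section \<open>Quantiles and the Rockafellar--Uryasev function\<close>

text \<open>Pointwise \<open>(y - \<beta>)\<^sub>+ \<ge> (y - v)\<^sub>+ + (v - \<beta>) 1\<^bsub>y > v\<^esub>\<close>, a subgradient inequality for \<open>\<beta> \<mapsto> (y - \<beta>)\<^sub>+\<close> at \<open>v\<close>.
  In expectation the indicator contributes \<open>(v - \<beta>) \<epsilon>\<close>, which cancels the linear term.\<close>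

lemma (in prob_space) Rockafellar_Uryasev_minimum:
  fixes Y :: "'a \<Rightarrow> real"
  assumes Y: "integrable M Y" and tail: "prob {x \<in> space M. v < Y x} = \<epsilon>"
  shows "\<epsilon> * v + expectation (\<lambda>x. max (Y x - v) 0) \<le> \<epsilon> * \<beta> + expectation (\<lambda>x. max (Y x - \<beta>) 0)"
proof -
  have [measurable]: "Y \<in> borel_measurable M"
    using Y by auto
  let ?A = "{x \<in> space M. v < Y x}"
  have A[measurable]: "?A \<in> sets M"
    by measurable
  have "expectation (\<lambda>x. max (Y x - v) 0 + (v - \<beta>) * indicator ?A x)
      \<le> expectation (\<lambda>x. max (Y x - \<beta>) 0)"
  proof (rule integral_mono)
    show "integrable M (\<lambda>x. max (Y x - v) 0 + (v - \<beta>) * indicator ?A x)"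
      using Y A by (auto simp: less_top[symmetric])
    show "integrable M (\<lambda>x. max (Y x - \<beta>) 0)"
      using Y by auto
  qed (auto simp: indicator_def)
  moreover have "expectation (\<lambda>x. max (Y x - v) 0 + (v - \<beta>) * indicator ?A x)
      = expectation (\<lambda>x. max (Y x - v) 0) + (v - \<beta>) * \<epsilon>"
    using Y A by (subst Bochner_Integration.integral_add) (auto simp: less_top[symmetric] tail[symmetric])
  ultimately show ?thesis
    by (simp add: algebra_simps)
qed

text \<open>Continuity makes \<open>{\<tau>. p \<le> cdf M \<tau>}\<close> closed, so its infimum belongs to it.  The value there does not
  exceed \<open>p\<close>, since \<open>p\<close> itself is attained by the intermediate value theorem.\<close>

lemma (in real_distribution) continuous_quantile:
  fixes p :: real
  defines "q \<equiv> Inf {\<tau>. p \<le> cdf M \<tau>}"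
  assumes cont: "\<And>x. isCont (cdf M) x" and p: "0 < p" "p < 1"
  shows cdf_at_quantile: "cdf M q = p"
    and le_cdf_iff_quantile_le: "p \<le> cdf M \<tau> \<longleftrightarrow> q \<le> \<tau>"
proof -
  let ?S = "{\<tau>. p \<le> cdf M \<tau>}"
  have "eventually (\<lambda>x. cdf M x < p) at_bot"
    using order_tendstoD(2)[OF cdf_lim_at_bot] p by blast
  then obtain l where l: "\<And>x. x \<le> l \<Longrightarrow> cdf M x < p"
    unfolding eventually_at_bot_linorder by blast
  have "eventually (\<lambda>x. p < cdf M x) at_top"
    using order_tendstoD(1)[OF cdf_lim_at_top_prob] p by blast
  then obtain u where u: "\<And>x. u \<le> x \<Longrightarrow> p < cdf M x"
    unfolding eventually_at_top_linorder by blast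
  have "l \<le> u"
    using l[of u] u[of u] by force
  then obtain z where z: "cdf M z = p"
    using IVT'[of "cdf M" l p u] l[of l] u[of u] cont
    by (auto simp: continuous_at_imp_continuous_on)
  have bdd: "bdd_below ?S"
    using l by (intro bdd_belowI[of _ l]) (metis linorder_le_cases mem_Collect_eq not_le)
  have "closed ?S"
    using cont by (intro closed_Collect_le continuous_on_const) (auto simp: continuous_at_imp_continuous_on)
  then have "q \<in> ?S"
    unfolding q_def using z bdd by (intro closed_contains_Inf) auto
  then show iff: "p \<le> cdf M \<tau> \<longleftrightarrow> q \<le> \<tau>" for \<tau>
    using cdf_nondecreasing[of q \<tau>] cInf_lower[OF _ bdd, of \<tau>] unfolding q_def by auto
  show "cdf M q = p"
    using iff[of q] iff[of z] z cdf_nondecreasing[of q z] by auto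
qed

section \<open>The standard elliptical distribution\<close>

lemma std_elliptical_density_properties:
  assumes "elliptical_generator g"
  shows std_elliptical_density_measurable: "std_elliptical_density g \<in> borel_measurable borel"
    and std_elliptical_density_nonneg: "0 \<le> std_elliptical_density g z"
    and std_elliptical_density_has_integral_1: "has_bochner_integral lborel (std_elliptical_density g) 1"
proof -
  have int: "integrable lborel (\<lambda>z. g (z\<^sup>2 / 2))"
    and pos: "0 < (LINT z|lborel. g (z\<^sup>2 / 2))" and nn: "\<And>z. 0 \<le> g (z\<^sup>2 / 2)"
    using assms by (simp_all add: elliptical_generator_def)
  have [measurable]: "(\<lambda>z. g (z\<^sup>2 / 2)) \<in> borel_measurable borel"
    using borel_measurable_integrable[OF int] by simp
  show "std_elliptical_density g \<in> borel_measurable borel"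
    unfolding std_elliptical_density_def[abs_def] by measurable
  show "0 \<le> std_elliptical_density g z"
    unfolding std_elliptical_density_def using pos nn by (intro divide_nonneg_pos)
  show "has_bochner_integral lborel (std_elliptical_density g) 1"
    using has_bochner_integral_divide_zero[OF has_bochner_integral_integrable[OF int],
      of "LINT z|lborel. g (z\<^sup>2 / 2)"] pos
    unfolding std_elliptical_density_def[abs_def] by simp
qed

lemma prob_space_std_elliptical:
  assumes g: "elliptical_generator g"
  shows "prob_space (std_elliptical g)"
proof (rule prob_spaceI)
  note [measurable] = std_elliptical_density_measurable[OF g]
  have "emeasure (std_elliptical g) (space (std_elliptical g))
      = (\<integral>\<^sup>+z. ennreal (std_elliptical_density g z) \<partial>lborel)"
    unfolding std_elliptical_def by (simp add: emeasure_density)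
  also have "\<dots> = 1"
    using std_elliptical_density_has_integral_1[OF g] std_elliptical_density_nonneg[OF g]
    by (subst nn_integral_eq_integral) (auto simp: has_bochner_integral_iff)
  finally show "emeasure (std_elliptical g) (space (std_elliptical g)) = 1" .
qed

lemma real_distribution_std_elliptical:
  "elliptical_generator g \<Longrightarrow> real_distribution (std_elliptical g)"
  unfolding real_distribution_def real_distribution_axioms_def
  using prob_space_std_elliptical by (auto simp: std_elliptical_def)

lemma cdf_std_elliptical:
  assumes g: "elliptical_generator g"
  shows "cdf (std_elliptical g) = std_elliptical_cdf g"
proof
  fix \<tau>
  interpret real_distribution "std_elliptical g"
    using g by (rule real_distribution_std_elliptical)
  note [measurable] = std_elliptical_density_measurable[OF g]
  have "cdf (std_elliptical g) \<tau> = expectation (indicat_real {..\<tau>})"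
    by (simp add: cdf_def)
  also have "\<dots> = std_elliptical_cdf g \<tau>"
    unfolding std_elliptical_def std_elliptical_cdf_def set_lebesgue_integral_def
    by (subst integral_density) (auto simp: std_elliptical_density_nonneg[OF g] mult.commute)
  finally show "cdf (std_elliptical g) \<tau> = std_elliptical_cdf g \<tau>" .
qed

lemma isCont_cdf_std_elliptical:
  assumes g: "elliptical_generator g"
  shows "isCont (cdf (std_elliptical g)) x"
proof -
  interpret real_distribution "std_elliptical g"
    using g by (rule real_distribution_std_elliptical)
  note [measurable] = std_elliptical_density_measurable[OF g]
  have "emeasure (std_elliptical g) {x} = 0"
    unfolding std_elliptical_def
    by (simp add: emeasure_density nn_integral_0_iff_AE AE_lborel_singleton)
  then show ?thesis
    by (simp add: isCont_cdf measure_def)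
qed

section \<open>Projections of a rank-one elliptical distribution\<close>

lemma rank_one_matrix_vector_mult:
  fixes \<mu> x :: "real^'n"
  shows "(\<chi> i j. \<mu> $ i * \<mu> $ j) *v x = (\<mu> \<bullet> x) *\<^sub>R \<mu>"
  by (simp add: vec_eq_iff matrix_vector_mult_def inner_vec_def sum_distrib_left sum_distrib_right mult_ac)

text \<open>The range of a rank-one matrix is a line, so invertibility forces the whole space to be the line
  through \<open>\<mu>\<close>: this is the case of dimension one, where the distribution is given by a density
  and not by its projections.\<close>

lemma invertible_rank_one_matrix_inv:
  fixes \<mu> :: "real^'n"
  defines "\<Sigma> \<equiv> (\<chi> i j. \<mu> $ i * \<mu> $ j)"
  assumes inv: "invertible \<Sigma>"
  shows invertible_rank_one_nonzero: "\<mu> \<noteq> 0"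
    and invertible_rank_one_span: "y = ((\<mu> \<bullet> y) / (\<mu> \<bullet> \<mu>)) *\<^sub>R \<mu>"
    and matrix_inv_rank_one: "matrix_inv \<Sigma> *v \<mu> = (1 / (\<mu> \<bullet> \<mu>)) *\<^sub>R \<mu>"
proof -
  have "\<Sigma> ** matrix_inv \<Sigma> = mat 1 \<and> matrix_inv \<Sigma> ** \<Sigma> = mat 1"
    using inv unfolding invertible_def matrix_inv_def by (rule someI_ex)
  then have right: "\<Sigma> *v (matrix_inv \<Sigma> *v y) = y"
    and left: "matrix_inv \<Sigma> *v (\<Sigma> *v y) = y" for y
    by (simp_all add: matrix_vector_mul_assoc)
  have mult: "\<Sigma> *v y = (\<mu> \<bullet> y) *\<^sub>R \<mu>" for y
    unfolding \<Sigma>_def by (rule rank_one_matrix_vector_mult)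
  have multiple: "\<exists>a. y = a *\<^sub>R \<mu>" for y
    using right[of y] mult by metis
  show nz: "\<mu> \<noteq> 0"
  proof
    assume "\<mu> = 0"
    then have "(axis undefined 1 :: real^'n) = 0"
      using multiple[of "axis undefined 1"] by simp
    then show False
      by (simp add: axis_eq_0_iff)
  qed
  show "y = ((\<mu> \<bullet> y) / (\<mu> \<bullet> \<mu>)) *\<^sub>R \<mu>" for y
  proof -
    obtain a where "y = a *\<^sub>R \<mu>"
      using multiple by blast
    then show ?thesis
      using nz by simp
  qed
  have "(\<mu> \<bullet> \<mu>) *\<^sub>R (matrix_inv \<Sigma> *v \<mu>) = \<mu>"
    using left[of \<mu>] by (simp add: mult matrix_vector_mult_scaleR)
  then show "matrix_inv \<Sigma> *v \<mu> = (1 / (\<mu> \<bullet> \<mu>)) *\<^sub>R \<mu>"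
    using nz by (simp add: scaleR_left_imp_eq[of "\<mu> \<bullet> \<mu>"])
qed

text \<open>The parametrization factors through the real line: the affine substitution \<open>w \<mapsto> a + a w\<close>, where
  \<open>v = a *\<^sub>R e\<close> for the unit vector \<open>e\<close>, followed by the isometry \<open>w \<mapsto> w *\<^sub>R e\<close>.  Only the former
  contributes a Jacobian.\<close>

lemma lborel_line_parametrization:
  fixes v :: "'a::euclidean_space"
  assumes v: "v \<noteq> 0" and line: "\<And>y. \<exists>a. y = a *\<^sub>R v"
  shows "lborel = distr (density lborel (\<lambda>_. ennreal (norm v))) borel (\<lambda>w. v + w *\<^sub>R v)"
proof -
  obtain e :: 'a where e: "e \<in> Basis"
    using nonempty_Basis by blast
  obtain r where r: "e = r *\<^sub>R v"
    using line by blast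
  define a where "a = 1 / r"
  have a: "v = a *\<^sub>R e" "a \<noteq> 0"
    using r nonzero_Basis[OF e] by (auto simp: a_def)
  have Basis: "Basis = {e}"
  proof -
    have "f = e" if f: "f \<in> Basis" for f
    proof (rule ccontr)
      assume "f \<noteq> e"
      then have "f \<bullet> e = 0" using e f by (simp add: inner_not_same_Basis)
      moreover obtain r where "f = r *\<^sub>R e" using line[of f] a by auto
      ultimately show False using e f nonzero_Basis by auto
    qed
    then show ?thesis using e by blast
  qed
  have unit: "lborel = distr lborel borel (\<lambda>w::real. w *\<^sub>R e)"
  proof (rule lborel_eqI)
    fix l u :: 'a
    assume le: "\<And>b. b \<in> Basis \<Longrightarrow> l \<bullet> b \<le> u \<bullet> b"
    have "(\<lambda>w::real. w *\<^sub>R e) -` box l u = {l \<bullet> e <..< u \<bullet> e}"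
      using e by (auto simp: mem_box Basis)
    then show "emeasure (distr lborel borel (\<lambda>w::real. w *\<^sub>R e)) (box l u) = (\<Prod>b\<in>Basis. (u - l) \<bullet> b)"
      using le e by (simp add: emeasure_distr Basis inner_diff_left)
  qed simp
  have "(lborel :: real measure) = density (distr lborel borel (\<lambda>w. a + a * w)) (\<lambda>_. ennreal \<bar>a\<bar>)"
    using a by (rule_tac lborel_real_affine)
  also have "\<dots> = distr (density lborel (\<lambda>_. ennreal \<bar>a\<bar>)) borel (\<lambda>w. a + a * w)"
    by (rule density_distr) auto
  finally have "lborel = distr (density lborel (\<lambda>_. ennreal \<bar>a\<bar>)) borel (\<lambda>w. a + a * w)" .
  with unit have "lborel = distr (distr (density lborel (\<lambda>_. ennreal \<bar>a\<bar>)) borel (\<lambda>w. a + a * w)) borel (\<lambda>w. w *\<^sub>R e)"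
    by (rule back_subst)
  also have "\<dots> = distr (density lborel (\<lambda>_. ennreal (norm v))) borel (\<lambda>w. v + w *\<^sub>R v)"
    using a e by (simp add: distr_distr comp_def scaleR_add_left mult.commute)
  finally show ?thesis .
qed

text \<open>In the coordinate \<open>w\<close> with \<open>z = \<mu> + w *\<^sub>R \<mu>\<close> the quadratic form of \<open>matrix_inv \<Sigma>\<close> is \<open>w\<^sup>2\<close>, so the
  density is proportional to the standard one.  Both have total mass one, so they are equal.\<close>

lemma elliptical_invertible_rank_one:
  fixes P :: "(real^'n) measure" and \<mu> :: "real^'n"
  assumes ell: "elliptical P \<mu> \<Sigma> g" and \<Sigma>: "\<Sigma> = (\<chi> i j. \<mu> $ i * \<mu> $ j)" and inv: "invertible \<Sigma>"
  shows "P = distr (std_elliptical g) borel (\<lambda>w. \<mu> + w *\<^sub>R \<mu>)"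
proof -
  let ?T = "\<lambda>w::real. \<mu> + w *\<^sub>R \<mu>"
  let ?I = "LINT y|lborel. g (y\<^sup>2 / 2)"
  note inv' = inv[unfolded \<Sigma>]
  interpret P: prob_space P
    using ell by (simp add: elliptical_def)
  obtain k where k: "k > 0"
    and P: "P = density lborel (\<lambda>z. ennreal (k * g ((1/2) * ((z - \<mu>) \<bullet> (matrix_inv \<Sigma> *v (z - \<mu>))))))"
    using ell inv by (auto simp: elliptical_def)
  have g: "elliptical_generator g"
    using ell by (simp add: elliptical_def)
  then have int: "integrable lborel (\<lambda>z. g (z\<^sup>2 / 2))" and pos: "0 < ?I" and nn: "\<And>z. 0 \<le> g (z\<^sup>2 / 2)"
    by (auto simp: elliptical_generator_def)
  have [measurable]: "(\<lambda>z. g (z\<^sup>2 / 2)) \<in> borel_measurable borel"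
    using int by auto
  have nz: "\<mu> \<noteq> 0"
    using invertible_rank_one_nonzero[OF inv'] .
  define h where "h z = ennreal (k * g ((((z - \<mu>) \<bullet> \<mu>) / (\<mu> \<bullet> \<mu>))\<^sup>2 / 2))" for z
  have [measurable]: "h \<in> borel_measurable borel"
  proof -
    have "(\<lambda>z. (\<lambda>w. g (w\<^sup>2 / 2)) (((z - \<mu>) \<bullet> \<mu>) / (\<mu> \<bullet> \<mu>))) \<in> borel_measurable borel"
      by measurable
    then show ?thesis unfolding h_def[abs_def] by measurable
  qed
  have quad: "(z - \<mu>) \<bullet> (matrix_inv \<Sigma> *v (z - \<mu>)) = (((z - \<mu>) \<bullet> \<mu>) / (\<mu> \<bullet> \<mu>))\<^sup>2" for z
  proof -
    let ?w = "((z - \<mu>) \<bullet> \<mu>) / (\<mu> \<bullet> \<mu>)"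
    have eq: "z - \<mu> = ?w *\<^sub>R \<mu>"
      using invertible_rank_one_span[OF inv', of "z - \<mu>"] by (simp add: inner_commute)
    have "matrix_inv \<Sigma> *v (z - \<mu>) = (?w / (\<mu> \<bullet> \<mu>)) *\<^sub>R \<mu>"
      by (subst eq) (simp add: matrix_vector_mult_scaleR matrix_inv_rank_one[OF inv', folded \<Sigma>])
    then show ?thesis
      by (simp add: power2_eq_square)
  qed
  have "P = density lborel h"
    unfolding P h_def[abs_def] by (simp add: quad)
  also have "\<dots> = density (distr (density lborel (\<lambda>_. ennreal (norm \<mu>))) borel ?T) h"
    by (subst lborel_line_parametrization[of \<mu>])
       (use nz invertible_rank_one_span[OF inv'] in auto)
  also have "\<dots> = distr (density lborel (\<lambda>w. ennreal (norm \<mu>) * h (?T w))) borel ?T"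
    by (simp add: density_distr density_density_eq)
  also have "(\<lambda>w. ennreal (norm \<mu>) * h (?T w)) = (\<lambda>w. ennreal (norm \<mu> * k * g (w\<^sup>2 / 2)))"
    using nz k nn by (auto simp: h_def ennreal_mult[symmetric] mult.assoc)
  finally have P': "P = distr (density lborel (\<lambda>w. ennreal (norm \<mu> * k * g (w\<^sup>2 / 2)))) borel ?T" .
  have "norm \<mu> * k * ?I = 1"
  proof -
    have "1 = emeasure P (space P)"
      by (simp add: P.emeasure_space_1)
    also have "\<dots> = (\<integral>\<^sup>+w. ennreal (norm \<mu> * k * g (w\<^sup>2 / 2)) \<partial>lborel)"
      unfolding P' by (simp add: emeasure_distr emeasure_density)
    also have "\<dots> = ennreal (norm \<mu> * k * ?I)"
      using int k nn by (subst nn_integral_eq_integral) auto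
    finally show ?thesis
      by (metis ennreal_eq_1)
  qed
  then have "norm \<mu> * k * g (w\<^sup>2 / 2) = std_elliptical_density g w" for w
    using pos by (simp add: std_elliptical_density_def field_simps)
  then show ?thesis
    unfolding P' by (simp add: std_elliptical_def)
qed

text \<open>The law of \<open>x \<bullet> \<zeta>\<close> in the same form whether or not \<open>\<Sigma>\<close> is invertible.  The sign of \<open>\<mu> \<bullet> x\<close> serves
  to drop the absolute value in \<open>sqrt (x \<bullet> (\<Sigma> *v x)) = \<bar>\<mu> \<bullet> x\<bar>\<close>.\<close>

lemma elliptical_rank_one_projection:
  fixes P :: "(real^'n) measure" and \<mu> :: "real^'n"
  assumes ell: "elliptical P \<mu> \<Sigma> g" and \<Sigma>: "\<Sigma> = (\<chi> i j. \<mu> $ i * \<mu> $ j)" and x: "0 \<le> \<mu> \<bullet> x"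
  shows "distr P borel (\<lambda>\<zeta>. x \<bullet> \<zeta>) = distr (std_elliptical g) borel (\<lambda>z. (\<mu> \<bullet> x) * (1 + z))"
proof (cases "invertible \<Sigma>")
  case True
  have [measurable_cong]: "sets (std_elliptical g) = sets borel"
    by (simp add: std_elliptical_def)
  show ?thesis
    unfolding elliptical_invertible_rank_one[OF ell \<Sigma> True]
    by (subst distr_distr) (auto simp: comp_def inner_add_right inner_commute algebra_simps)
next
  case False
  have "sqrt (x \<bullet> (\<Sigma> *v x)) = \<mu> \<bullet> x"
    using x by (simp add: \<Sigma> rank_one_matrix_vector_mult inner_commute)
  then show ?thesis
    using ell False by (simp add: elliptical_def algebra_simps)
qed

section \<open>Reduction to a scalar problem\<close>

context
  fixes P :: "(real^'n) measure" and \<mu> :: "real^'n" and \<Sigma> :: "real^'n^'n"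
    and g :: "real \<Rightarrow> real" and b \<epsilon> \<theta> :: real
  assumes \<epsilon>: "0 < \<epsilon>" "\<epsilon> < 1"
    and ell: "elliptical P \<mu> \<Sigma> g"
    and rank_one: "\<Sigma> = (\<chi> i j. \<mu> $ i * \<mu> $ j)"
begin

text \<open>The \<open>(1 - \<epsilon>)\<close>-quantile of \<open>1 + \<theta> + Z\<close>, that is, of the left-hand side of the constraint for a
  decision with \<open>\<mu> \<bullet> x = 1\<close>.\<close>

abbreviation (input) "standardized_threshold \<equiv> 1 + std_elliptical_quantile g (1 - \<epsilon>) + \<theta>"

interpretation Z: real_distribution "std_elliptical g"
  using ell by (intro real_distribution_std_elliptical) (simp add: elliptical_def)

lemma elliptical_sets: "sets P = sets borel"
  using ell by (simp add: elliptical_def)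

lemma mahalanobis_dual_norm_rank_one:
  "0 \<le> \<mu> \<bullet> x \<Longrightarrow> mahalanobis_dual_norm \<Sigma> x = \<mu> \<bullet> x"
  by (simp add: mahalanobis_dual_norm_def rank_one rank_one_matrix_vector_mult inner_commute)

lemma le_cdf_iff_std_elliptical_quantile_le:
  "1 - \<epsilon> \<le> cdf (std_elliptical g) \<tau> \<longleftrightarrow> std_elliptical_quantile g (1 - \<epsilon>) \<le> \<tau>"
  and cdf_std_elliptical_quantile:
  "cdf (std_elliptical g) (std_elliptical_quantile g (1 - \<epsilon>)) = 1 - \<epsilon>"
proof -
  have g: "elliptical_generator g"
    using ell by (simp add: elliptical_def)
  have "0 < 1 - \<epsilon>" "1 - \<epsilon> < 1"
    using \<epsilon> by auto
  note quantile = Z.continuous_quantile[OF isCont_cdf_std_elliptical[OF g] this]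
  have Inf: "std_elliptical_quantile g (1 - \<epsilon>) = Inf {\<tau>. 1 - \<epsilon> \<le> cdf (std_elliptical g) \<tau>}"
    by (simp add: std_elliptical_quantile_def cdf_std_elliptical[OF g])
  show "1 - \<epsilon> \<le> cdf (std_elliptical g) \<tau> \<longleftrightarrow> std_elliptical_quantile g (1 - \<epsilon>) \<le> \<tau>"
    and "cdf (std_elliptical g) (std_elliptical_quantile g (1 - \<epsilon>)) = 1 - \<epsilon>"
    unfolding Inf by (rule quantile)+
qed

text \<open>For \<open>\<mu> \<bullet> x > 0\<close> divide the constraint by \<open>\<mu> \<bullet> x\<close> and compare with the quantile.  For \<open>\<mu> \<bullet> x = 0\<close> the
  constraint is the deterministic condition \<open>0 \<le> b\<close>, whose probability is zero or one.\<close>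

lemma chance_constraint_iff_scaled_quantile:
  assumes x: "0 \<le> \<mu> \<bullet> x"
  shows "chance_constraint P \<Sigma> \<theta> b \<epsilon> x \<longleftrightarrow> (\<mu> \<bullet> x) * standardized_threshold \<le> b"
proof -
  let ?s = "\<mu> \<bullet> x"
  have [measurable]: "(\<lambda>\<zeta>. x \<bullet> \<zeta>) \<in> measurable P borel"
    by (subst measurable_cong_sets[OF elliptical_sets refl]) simp
  have "measure P {\<zeta> \<in> space P. \<theta> * mahalanobis_dual_norm \<Sigma> x + x \<bullet> \<zeta> \<le> b}
      = measure (distr P borel (\<lambda>\<zeta>. x \<bullet> \<zeta>)) {..b - \<theta> * ?s}"
    by (subst measure_distr)
       (auto simp: mahalanobis_dual_norm_rank_one[OF x] intro!: arg_cong[where f = "measure P"])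
  also have "\<dots> = Z.prob {z. ?s * (1 + \<theta> + z) \<le> b}"
    unfolding elliptical_rank_one_projection[OF ell rank_one x]
    by (subst measure_distr)
       (auto simp: algebra_simps intro!: arg_cong[where f = Z.prob])
  finally have prob: "chance_constraint P \<Sigma> \<theta> b \<epsilon> x
      \<longleftrightarrow> 1 - \<epsilon> \<le> Z.prob {z. ?s * (1 + \<theta> + z) \<le> b}"
    by (simp add: chance_constraint_def)
  show ?thesis
  proof (cases "?s = 0")
    case True
    then show ?thesis
      using prob \<epsilon> Z.prob_space by (cases "0 \<le> b") auto
  next
    case False
    with x have "0 < ?s" by simp
    then have "{z. ?s * (1 + \<theta> + z) \<le> b} = {..b / ?s - 1 - \<theta>}"
      by (auto simp: field_simps)
    then have "chance_constraint P \<Sigma> \<theta> b \<epsilon> x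
        \<longleftrightarrow> std_elliptical_quantile g (1 - \<epsilon>) \<le> b / ?s - 1 - \<theta>"
      using prob le_cdf_iff_std_elliptical_quantile_le by (simp add: cdf_def)
    also have "\<dots> \<longleftrightarrow> ?s * standardized_threshold \<le> b"
      using \<open>0 < ?s\<close> by (simp add: field_simps)
    finally show ?thesis .
  qed
qed

lemma alsox_objective_scaled:
  assumes x: "0 \<le> \<mu> \<bullet> x"
  shows "alsox_objective P \<Sigma> \<theta> b \<epsilon> (x, \<beta>)
    = \<epsilon> * \<beta> + Z.expectation (\<lambda>z. max ((\<mu> \<bullet> x) * (1 + \<theta> + z) - b - \<beta>) 0)"
proof -
  let ?s = "\<mu> \<bullet> x"
  let ?f = "\<lambda>y. max (\<theta> * ?s + y - b - \<beta>) 0"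
  have [measurable]: "(\<lambda>\<zeta>. x \<bullet> \<zeta>) \<in> measurable P borel"
    by (subst measurable_cong_sets[OF elliptical_sets refl]) simp
  have "(LINT \<zeta>|P. ?f (x \<bullet> \<zeta>)) = (LINT y|distr P borel (\<lambda>\<zeta>. x \<bullet> \<zeta>). ?f y)"
    by (subst integral_distr) auto
  also have "\<dots> = Z.expectation (\<lambda>z. ?f (?s * (1 + z)))"
    unfolding elliptical_rank_one_projection[OF ell rank_one x] by (subst integral_distr) auto
  finally show ?thesis
    by (simp add: alsox_objective_def mahalanobis_dual_norm_rank_one[OF x] algebra_simps)
qed

text \<open>The tail assumption is on \<open>P\<close>, and it passes to \<open>Z\<close> through any projection with a positive scale.\<close>

lemma integrable_std_elliptical:
  assumes P: "sub_gaussian P" and x: "0 < \<mu> \<bullet> x"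
  shows "integrable (std_elliptical g) (\<lambda>z. z)"
proof -
  let ?s = "\<mu> \<bullet> x"
  have [measurable]: "(\<lambda>\<zeta>. x \<bullet> \<zeta>) \<in> measurable P borel"
    by (subst measurable_cong_sets[OF elliptical_sets refl]) simp
  have "integrable P (\<lambda>\<zeta>. norm x * norm \<zeta>)"
    using sub_gaussian_integrable_norm[OF _ elliptical_sets P] ell by (simp add: elliptical_def)
  then have "integrable P (\<lambda>\<zeta>. x \<bullet> \<zeta>)"
    by (rule Bochner_Integration.integrable_bound) (auto simp: Cauchy_Schwarz_ineq2)
  then have "integrable (distr P borel (\<lambda>\<zeta>. x \<bullet> \<zeta>)) (\<lambda>y. y)"
    by (subst integrable_distr_eq) auto
  then have "integrable (std_elliptical g) (\<lambda>z. ?s * (1 + z))"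
    unfolding elliptical_rank_one_projection[OF ell rank_one less_imp_le[OF x]]
    by (subst (asm) integrable_distr_eq) auto
  then have "integrable (std_elliptical g) (\<lambda>z. (1 / ?s) * (?s * (1 + z)) - 1)"
    by (rule Bochner_Integration.integrable_diff[OF integrable_mult_right Z.integrable_const])
  moreover have "(\<lambda>z. (1 / ?s) * (?s * (1 + z)) - 1) = (\<lambda>z. z)"
    using x by auto
  ultimately show ?thesis
    by simp
qed

text \<open>The mean excess \<open>E(Z - q)\<^sub>+\<close>: the slope, beyond \<open>\<epsilon>\<close> times the threshold, of the minimal objective
  as a function of \<open>\<mu> \<bullet> x\<close>.\<close>

abbreviation (input) "quantile_excess \<equiv>
  Z.expectation (\<lambda>z. max (z - std_elliptical_quantile g (1 - \<epsilon>)) 0)"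

lemma expected_excess_at_quantile:
  assumes "0 \<le> s"
  shows "Z.expectation (\<lambda>z. max (s * (1 + \<theta> + z) - b - (s * standardized_threshold - b)) 0)
    = s * quantile_excess"
proof -
  let ?q = "std_elliptical_quantile g (1 - \<epsilon>)"
  have "max (s * (1 + \<theta> + z) - b - (s * standardized_threshold - b)) 0 = s * max (z - ?q) 0" for z
    using assms max_mult_distrib_left[of s "z - ?q" 0] by (simp add: algebra_simps)
  then show ?thesis
    by simp
qed

lemma alsox_objective_at_quantile:
  assumes "0 \<le> \<mu> \<bullet> x"
  shows "alsox_objective P \<Sigma> \<theta> b \<epsilon> (x, (\<mu> \<bullet> x) * standardized_threshold - b)
    = \<epsilon> * ((\<mu> \<bullet> x) * standardized_threshold - b) + (\<mu> \<bullet> x) * quantile_excess"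
  by (simp only: alsox_objective_scaled[OF assms] expected_excess_at_quantile[OF assms])

text \<open>The event that \<open>s (1 + \<theta> + Z) - b\<close> exceeds its quantile is \<open>Z > q\<close>, which has probability exactly \<open>\<epsilon>\<close>,
  so the Rockafellar--Uryasev inequality applies.  This needs \<open>s > 0\<close>: for \<open>s = 0\<close> the event is empty.\<close>

lemma alsox_objective_lower_bound:
  assumes P: "sub_gaussian P" and x: "0 < \<mu> \<bullet> x"
  shows "\<epsilon> * ((\<mu> \<bullet> x) * standardized_threshold - b) + (\<mu> \<bullet> x) * quantile_excess
    \<le> alsox_objective P \<Sigma> \<theta> b \<epsilon> (x, \<beta>)"
proof -
  let ?s = "\<mu> \<bullet> x" and ?q = "std_elliptical_quantile g (1 - \<epsilon>)"
  let ?Y = "\<lambda>z. ?s * (1 + \<theta> + z) - b" and ?v = "?s * standardized_threshold - b"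
  have int: "integrable (std_elliptical g) ?Y"
    using integrable_std_elliptical[OF P x] by simp
  have "{z \<in> space (std_elliptical g). ?v < ?Y z} = space (std_elliptical g) - {..?q}"
    using x by (auto simp: algebra_simps)
  then have "Z.prob {z \<in> space (std_elliptical g). ?v < ?Y z} = 1 - cdf (std_elliptical g) ?q"
    by (simp only: cdf_def) (simp add: Z.prob_compl[symmetric] del: Z.space_eq_univ)
  then have tail: "Z.prob {z \<in> space (std_elliptical g). ?v < ?Y z} = \<epsilon>"
    by (simp add: cdf_std_elliptical_quantile)
  show ?thesis
    using Z.Rockafellar_Uryasev_minimum[OF int tail, of \<beta>]
    by (simp only: alsox_objective_scaled[OF less_imp_le[OF x]]
        expected_excess_at_quantile[OF less_imp_le[OF x]])
qed

section \<open>Exactness\<close>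

text \<open>A minimizer \<open>y\<close> that violates the constraint is beaten by the feasible decision \<open>x\<close> paired with its
  own quantile \<open>\<beta>\<close>, which is nonpositive because \<open>x\<close> is feasible.  The comparison is strict because
  the minimal objective over \<open>\<beta>\<close> is strictly increasing in \<open>\<mu> \<bullet> x\<close> between the two decisions.\<close>

lemma alsox_minimizer_satisfies_chance_constraint:
  assumes P: "sub_gaussian P" and nonneg: "\<forall>x\<in>X. 0 \<le> \<mu> \<bullet> x"
    and threshold: "0 \<le> standardized_threshold"
    and x: "drccp_feasible P \<Sigma> \<theta> b \<epsilon> X x" "c \<bullet> x \<le> t"
    and min: "(y, \<beta>) \<in> alsox_argmin P \<Sigma> \<theta> b \<epsilon> X c t"
  shows "chance_constraint P \<Sigma> \<theta> b \<epsilon> y"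
proof (rule ccontr)
  assume violated: "\<not> chance_constraint P \<Sigma> \<theta> b \<epsilon> y"
  let ?\<kappa> = standardized_threshold
  let ?\<beta>x = "(\<mu> \<bullet> x) * ?\<kappa> - b"
  have "x \<in> X" and feasible: "chance_constraint P \<Sigma> \<theta> b \<epsilon> x"
    using x by (auto simp: drccp_feasible_def)
  then have s: "0 \<le> \<mu> \<bullet> x"
    using nonneg by blast
  have "y \<in> X"
    using min by (simp add: alsox_argmin_def is_arg_min_def alsox_feasible_def)
  then have s': "0 \<le> \<mu> \<bullet> y"
    using nonneg by blast
  have x_le: "(\<mu> \<bullet> x) * ?\<kappa> \<le> b"
    using feasible chance_constraint_iff_scaled_quantile[OF s] by simp
  have y_gt: "b < (\<mu> \<bullet> y) * ?\<kappa>"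
    using violated chance_constraint_iff_scaled_quantile[OF s'] by simp
  have less: "(\<mu> \<bullet> x) * ?\<kappa> < (\<mu> \<bullet> y) * ?\<kappa>"
    using x_le y_gt by linarith
  then have gt: "\<mu> \<bullet> x < \<mu> \<bullet> y"
    using threshold by (meson mult_right_mono not_le)
  have "\<epsilon> * ?\<beta>x < \<epsilon> * ((\<mu> \<bullet> y) * ?\<kappa> - b)"
    using less \<epsilon> by simp
  moreover have "(\<mu> \<bullet> x) * quantile_excess \<le> (\<mu> \<bullet> y) * quantile_excess"
    using gt by (intro mult_right_mono Bochner_Integration.integral_nonneg) auto
  ultimately have "alsox_objective P \<Sigma> \<theta> b \<epsilon> (x, ?\<beta>x) < alsox_objective P \<Sigma> \<theta> b \<epsilon> (y, \<beta>)"
    using alsox_objective_at_quantile[OF s] alsox_objective_lower_bound[OF P le_less_trans[OF s gt], of \<beta>]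
    by linarith
  moreover have "alsox_feasible X c t (x, ?\<beta>x)"
    using \<open>x \<in> X\<close> x(2) x_le by (simp add: alsox_feasible_def)
  ultimately show False
    using min by (auto simp: alsox_argmin_def is_arg_min_def)
qed

end

theorem corollary4:
  fixes P :: "(real^'n) measure" and \<mu> c :: "real^'n" and \<Sigma> :: "real^'n^'n"
    and g :: "real \<Rightarrow> real" and X :: "(real^'n) set" and b\<^sub>1 \<epsilon> \<theta> :: real
  assumes "0 < \<epsilon>" and "\<epsilon> < 1" and "0 \<le> \<theta>"
    and "elliptical P \<mu> \<Sigma> g" and "sub_gaussian P"
    and "\<Sigma> = (\<chi> i j. \<mu> $ i * \<mu> $ j)"
    and "\<forall>x\<in>X. 0 \<le> \<mu> \<bullet> x"
    and "0 \<le> 1 + std_elliptical_quantile g (1 - \<epsilon>) + \<theta>"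
    and drccp_attained: "(\<exists>x. drccp_feasible P \<Sigma> \<theta> b\<^sub>1 \<epsilon> X x) \<Longrightarrow>
           \<exists>x. is_arg_min (\<lambda>x. c \<bullet> x) (drccp_feasible P \<Sigma> \<theta> b\<^sub>1 \<epsilon> X) x"
    and alsox_attained: "\<And>t. (\<exists>p. alsox_feasible X c t p) \<Longrightarrow>
           alsox_argmin P \<Sigma> \<theta> b\<^sub>1 \<epsilon> X c t \<noteq> {}"
  shows "alsox_value P \<Sigma> \<theta> b\<^sub>1 \<epsilon> X c = drccp_value P \<Sigma> \<theta> b\<^sub>1 \<epsilon> X c"
proof (rule antisym)
  show "alsox_value P \<Sigma> \<theta> b\<^sub>1 \<epsilon> X c \<le> drccp_value P \<Sigma> \<theta> b\<^sub>1 \<epsilon> X c"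
    unfolding drccp_value_def
  proof (rule Inf_greatest, clarify)
    fix x
    assume x: "drccp_feasible P \<Sigma> \<theta> b\<^sub>1 \<epsilon> X x"
    then have "alsox_feasible X c (c \<bullet> x) (x, 0)"
      by (simp add: alsox_feasible_def drccp_feasible_def)
    then obtain y \<beta> where min: "(y, \<beta>) \<in> alsox_argmin P \<Sigma> \<theta> b\<^sub>1 \<epsilon> X c (c \<bullet> x)"
      using alsox_attained[of "c \<bullet> x"] by fast
    have "chance_constraint P \<Sigma> \<theta> b\<^sub>1 \<epsilon> y"
      using alsox_minimizer_satisfies_chance_constraint[OF assms(1,2,4,6,5,7,8) x order_refl min] .
    with min show "alsox_value P \<Sigma> \<theta> b\<^sub>1 \<epsilon> X c \<le> ereal (c \<bullet> x)"
      unfolding alsox_value_def by (intro Inf_lower) blast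
  qed
  show "drccp_value P \<Sigma> \<theta> b\<^sub>1 \<epsilon> X c \<le> alsox_value P \<Sigma> \<theta> b\<^sub>1 \<epsilon> X c"
    unfolding alsox_value_def
  proof (rule Inf_greatest, clarify)
    fix t y \<beta>
    assume min: "(y, \<beta>) \<in> alsox_argmin P \<Sigma> \<theta> b\<^sub>1 \<epsilon> X c t"
      and y: "chance_constraint P \<Sigma> \<theta> b\<^sub>1 \<epsilon> y"
    have "y \<in> X" "c \<bullet> y \<le> t"
      using min by (auto simp: alsox_argmin_def is_arg_min_def alsox_feasible_def)
    with y have "drccp_value P \<Sigma> \<theta> b\<^sub>1 \<epsilon> X c \<le> ereal (c \<bullet> y)"
      unfolding drccp_value_def drccp_feasible_def by (intro Inf_lower) blast
    also have "\<dots> \<le> ereal t"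
      using \<open>c \<bullet> y \<le> t\<close> by simp
    finally show "drccp_value P \<Sigma> \<theta> b\<^sub>1 \<epsilon> X c \<le> ereal t" .
  qed
qed

end
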